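(* Let $A\in\mathbb{R}^{m\times n}$, let $c\in\mathbb{R}^n$ with $c\ge 0$ and $c\neq 0$, let $\mathcal{K}$ be a finite index set, and for each $k\in\mathcal{K}$ let $b_k\in\mathbb{R}^m$ and let $x_k^*\in\mathbb{R}^n$ be an optimal solution of the linear optimization problem $\min\{c^\top x : Ax=b_k,\ x\ge 0\}$. Let $\mathcal{U}=\mathcal{C}\cap\Delta$, where $\mathcal{C}$ is the inverse-feasible set of the data $A,\{(b_k,x_k^* )\}_{k\in\mathcal{K}}$ and $\Delta$ is the unit simplex in $\mathbb{R}^n$. For $k\in\mathcal{K}$ put $\mathcal{N}_k=\{j\in\{1,\dots,n\} : [x_k^*]_j=0\}$. Let $b\in\mathbb{R}^m$. Then the robust linear optimization problem $$\min_{x\in\mathbb{R}^n}\ \max_{c'\in\mathcal{U}}\ c'^\top x\quad\text{s.t.}\quad Ax=b,\ x\ge 0$$ is equivalent to the linear optimization problem, in the variables $x\in\mathbb{R}^n$, $\xi_k\in\mathbb{R}^n$ $(k\in\mathcal{K})$, $\zeta\in\mathbb{R}$, $$\begin{aligned}\min_{x,\{\xi_k\},\zeta}\quad & \zeta\\ \text{s.t.}\quad & \zeta\mathbf{1}\ge \sum_{k\in\mathcal{K}}\xi_k+x,\\ & A\xi_k=0\quad (k\in\mathcal{K}),\\ & [\xi_k]_j\ge 0\quad (k\in\mathcal{K},\ j\in\mathcal{N}_k),\\ & Ax=b,\\ & x\ge 0,\end{aligned}$$ in the following sense: the two problems have the same optimal value, and $x$ is an optimal solution of the robust problem if and only if there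 exist $\{\xi_k\}_{k\in\mathcal{K}}$ and $\zeta$ such that $(x,\{\xi_k\},\zeta)$ is an optimal solution of the linear optimization problem.
   Context: Vector inequalities are componentwise, $[v]_j$ denotes the $j$-th entry of a vector $v$, and $\mathbf{1}\in\mathbb{R}^n$ is the all-one vector. The vector $c$ is the unknown true objective coefficient; the matrix $A$ and the pairs $(b_k,x_k^* )$ are the observed data. For each $k\in\mathcal{K}$ define $$C_k=\{A^\top y_k+s_k : y_k\in\mathbb{R}^m,\ s_k\in\mathbb{R}^n,\ s_k\ge 0,\ x_k^{*\top}s_k=0\},$$ and define the inverse-feasible set $\mathcal{C}=\bigcap_{k\in\mathcal{K}}C_k\subseteq\mathbb{R}^n$ (an empty intersection being $\mathbb{R}^n$). The unit simplex is $\Delta=\{c'\in\mathbb{R}^n : \mathbf{1}^\top c'=1,\ c'\ge 0\}$. The optimal value of an infeasible minimization problem is $+\infty$ by convention. *)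

theory Defs
  imports "HOL-Analysis.Analysis"
begin

text \<open>
  On \<^typ>\<open>real ^ 'n\<close> the order \<open>\<le>\<close> is componentwise and \<open>1\<close> is the all-one vector.
\<close>

definition lp_feasible :: "real ^ 'n ^ 'm \<Rightarrow> real ^ 'm \<Rightarrow> (real ^ 'n) set" where
  "lp_feasible A b = {x. A *v x = b \<and> 0 \<le> x}"

definition inverse_feasible_single :: "real ^ 'n ^ 'm \<Rightarrow> real ^ 'n \<Rightarrow> (real ^ 'n) set" where
  "inverse_feasible_single A xs = {transpose A *v y + s | y s. 0 \<le> s \<and> xs \<bullet> s = 0}"

text \<open>For \<open>K = {}\<close> the intersection is \<^term>\<open>UNIV\<close>.\<close>

definition inverse_feasible ::
    "real ^ 'n ^ 'm \<Rightarrow> 'k set \<Rightarrow> ('k \<Rightarrow> real ^ 'n) \<Rightarrow> (real ^ 'n) set" where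
  "inverse_feasible A K xs = (\<Inter>k\<in>K. inverse_feasible_single A (xs k))"

definition unit_simplex :: "(real ^ 'n) set" where
  "unit_simplex = {c. 1 \<bullet> c = 1 \<and> 0 \<le> c}"

definition uncertainty_set ::
    "real ^ 'n ^ 'm \<Rightarrow> 'k set \<Rightarrow> ('k \<Rightarrow> real ^ 'n) \<Rightarrow> (real ^ 'n) set" where
  "uncertainty_set A K xs = inverse_feasible A K xs \<inter> unit_simplex"

text \<open>
  The inner maximum is written as a supremum in the extended reals. The uncertainty set is
  compact, so the supremum is an attained, finite maximum whenever that set is nonempty.
\<close>

definition robust_objective :: "(real ^ 'n) set \<Rightarrow> real ^ 'n \<Rightarrow> ereal" where
  "robust_objective U x = (SUP c\<in>U. ereal (c \<bullet> x))"

definition zero_indices :: "real ^ 'n \<Rightarrow> 'n set" where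
  "zero_indices x = {j. x $ j = 0}"

text \<open>
  The variables are triples \<open>(x, \<xi>, \<zeta>)\<close>. Values of the family \<open>\<xi>\<close> outside \<open>K\<close> occur neither
  in the constraints nor in the objective.
\<close>

definition reformulation_feasible ::
    "real ^ 'n ^ 'm \<Rightarrow> 'k set \<Rightarrow> ('k \<Rightarrow> real ^ 'n) \<Rightarrow> real ^ 'm
      \<Rightarrow> ((real ^ 'n) \<times> ('k \<Rightarrow> real ^ 'n) \<times> real) set" where
  "reformulation_feasible A K xs b =
     {(x, \<xi>, \<zeta>).
        (\<Sum>k\<in>K. \<xi> k) + x \<le> \<zeta> *\<^sub>R 1 \<and>
        (\<forall>k\<in>K. A *v \<xi> k = 0) \<and>
        (\<forall>k\<in>K. \<forall>j\<in>zero_indices (xs k). 0 \<le> \<xi> k $ j) \<and>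
        A *v x = b \<and>
        0 \<le> x}"

definition reformulation_objective ::
    "(real ^ 'n) \<times> ('k \<Rightarrow> real ^ 'n) \<times> real \<Rightarrow> ereal" where
  "reformulation_objective = (\<lambda>(x, \<xi>, \<zeta>). ereal \<zeta>)"

text \<open>
  The infimum over the empty set is \<open>\<infinity>\<close>, the value of an infeasible problem.
\<close>

definition optimal_value :: "('a \<Rightarrow> ereal) \<Rightarrow> 'a set \<Rightarrow> ereal" where
  "optimal_value f S = (INF x\<in>S. f x)"

definition optimal_solution :: "('a \<Rightarrow> ereal) \<Rightarrow> 'a set \<Rightarrow> 'a \<Rightarrow> bool" where
  "optimal_solution f S x \<longleftrightarrow> is_arg_min f (\<lambda>y. y \<in> S) x"

end

theory Submission
  imports Defs
begin

text \<open>
  Each cone of objectives making an observed point optimal is polyhedral, and its dual cone is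
  the set of admissible \<open>\<xi> k\<close>. A number \<open>\<zeta>\<close> bounds \<open>c \<bullet> x\<close> on the uncertainty set if and only if
  \<open>\<zeta> *\<^sub>R 1 - x\<close> lies in the dual of the intersection of these cones with the nonnegative orthant;
  by polyhedrality this dual is the sum of the dual cones and the orthant. The true objective
  lies in every cone, so the uncertainty set is nonempty and the worst case is a real number,
  attained as a value of \<open>\<zeta>\<close>.
\<close>

section \<open>Separation, Farkas' lemma and halfspace descriptions of convex cones\<close>

text \<open>A strictly separating hyperplane can be moved to the origin: since \<open>0\<close> lies
  in the cone, the offset \<beta> is negative, and a point of the cone with negative inner product
  could be rescaled to have inner product exactly \<beta>.\<close>

lemma closed_convex_cone_separation:
  fixes S :: "'a::euclidean_space set"
  assumes "closed S" "convex_cone S" "v \<notin> S"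
  obtains a where "\<And>x. x \<in> S \<Longrightarrow> 0 \<le> a \<bullet> x" "a \<bullet> v < 0"
proof -
  obtain a \<beta> where av: "a \<bullet> v < \<beta>" and gt: "\<And>x. x \<in> S \<Longrightarrow> \<beta> < a \<bullet> x"
    using separating_hyperplane_closed_point[of S v] assms by (auto simp: convex_cone_def)
  have \<beta>: "\<beta> < 0"
    using gt[of 0] convex_cone_contains_0[OF assms(2)] by simp
  have "0 \<le> a \<bullet> x" if "x \<in> S" for x
  proof (rule ccontr)
    assume neg: "\<not> 0 \<le> a \<bullet> x"
    then have "(\<beta> / (a \<bullet> x)) *\<^sub>R x \<in> S"
      using convex_cone_scaleR[OF assms(2) _ that] \<beta> by (simp add: divide_nonpos_neg)
    then show False
      using gt neg by fastforce
  qed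
  moreover have "a \<bullet> v < 0"
    using av \<beta> by linarith
  ultimately show thesis
    using that by blast
qed

text \<open>A finitely generated convex cone is closed, so a vector outside it is cut off by some
  \<open>x\<close> that is nonnegative on all generators and negative on \<open>v\<close>.\<close>

lemma farkas_convex_cone_hull:
  fixes F :: "'a::euclidean_space set"
  assumes "finite F"
    and "\<And>x. (\<And>a. a \<in> F \<Longrightarrow> 0 \<le> a \<bullet> x) \<Longrightarrow> 0 \<le> x \<bullet> v"
  shows "v \<in> convex_cone hull F"
proof (rule ccontr)
  assume "v \<notin> convex_cone hull F"
  then obtain x where x: "\<And>a. a \<in> convex_cone hull F \<Longrightarrow> 0 \<le> x \<bullet> a" "x \<bullet> v < 0"
    using closed_convex_cone_separation[OF closed_convex_cone_hull[OF assms(1)]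
        convex_cone_convex_cone_hull] by blast
  then show False
    using assms(2)[of x] by (metis hull_inc inner_commute not_le)
qed

text \<open>The halfspaces of a polyhedral cone can be made homogeneous. Each bound is nonnegative
  because the cone contains \<open>0\<close>; positive scaling then forces
  \<open>f h \<bullet> x \<le> 0\<close> on the cone, so replacing every bound by \<open>0\<close>
  leaves the set unchanged.\<close>

lemma polyhedral_convex_cone_halfspaces:
  fixes S :: "'a::euclidean_space set"
  assumes "polyhedron S" "convex_cone S"
  obtains F where "finite F" "S = {x. \<forall>a\<in>F. 0 \<le> a \<bullet> x}"
proof -
  obtain H where H: "finite H" "S = \<Inter>H"
    and "\<forall>h\<in>H. \<exists>a \<beta>. a \<noteq> 0 \<and> h = {x. a \<bullet> x \<le> \<beta>}"
    using assms(1) unfolding polyhedron_def by blast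
  then obtain f \<beta> where h: "\<And>h. h \<in> H \<Longrightarrow> h = {x. f h \<bullet> x \<le> \<beta> h}"
    by metis
  have nonneg: "0 \<le> \<beta> h" if "h \<in> H" for h
  proof -
    have "0 \<in> h"
      using convex_cone_contains_0[OF assms(2)] H(2) that by blast
    then show ?thesis
      using h[OF that] by (metis inner_zero_right mem_Collect_eq)
  qed
  have nonpos: "f h \<bullet> x \<le> 0" if "h \<in> H" "x \<in> S" for h x
  proof (rule ccontr)
    assume pos: "\<not> f h \<bullet> x \<le> 0"
    \<comment> \<open>The factor makes the inner product with \<open>f h\<close> equal to
      \<open>\<beta> h + 1\<close>, beyond the bound.\<close>
    have "((\<beta> h + 1) / (f h \<bullet> x)) *\<^sub>R x \<in> S"
      using convex_cone_scaleR[OF assms(2) _ that(2)] pos nonneg[OF that(1)] by simp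
    then have "f h \<bullet> (((\<beta> h + 1) / (f h \<bullet> x)) *\<^sub>R x) \<le> \<beta> h"
      using H(2) h[OF that(1)] that(1) by blast
    then show False
      using pos by simp
  qed
  have "S = {x. \<forall>a\<in>(\<lambda>h. - f h) ` H. 0 \<le> a \<bullet> x}"
    using H(2) h nonneg nonpos by (fastforce intro: order_trans)
  then show thesis
    using that H(1) by blast
qed

section \<open>The cone of a single observation: generators, dual cone, membership of the true
  objective\<close>

lemma inner_transpose_matrix_vector:
  fixes A :: "real ^ 'n ^ 'm"
  shows "(transpose A *v y) \<bullet> x = y \<bullet> (A *v x)"
  by (metis dot_lmul_matrix transpose_matrix_vector)

lemma inner_nonneg_vec:
  fixes x y :: "real ^ 'n"
  assumes "0 \<le> x" "0 \<le> y"
  shows "0 \<le> x \<bullet> y"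
  using assms by (auto simp: inner_vec_def less_eq_vec_def intro!: sum_nonneg)

text \<open>Complementary slackness: a sum of nonnegative products vanishes only if each product
  does, so orthogonality to \<open>xs\<close> becomes a condition on the support of
  \<open>s\<close>.\<close>

lemma inverse_feasible_single_altdef:
  fixes A :: "real ^ 'n ^ 'm"
  assumes "0 \<le> xs"
  shows "inverse_feasible_single A xs
    = {transpose A *v y + s | y s. 0 \<le> s \<and> (\<forall>j. j \<notin> zero_indices xs \<longrightarrow> s $ j = 0)}"
proof -
  have "xs \<bullet> s = 0 \<longleftrightarrow> (\<forall>j. j \<notin> zero_indices xs \<longrightarrow> s $ j = 0)" if "0 \<le> s" for s
  proof -
    have "xs \<bullet> s = 0 \<longleftrightarrow> (\<forall>j. xs $ j * s $ j = 0)"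
      unfolding inner_vec_def
      using assms that by (subst sum_nonneg_eq_0_iff) (auto simp: less_eq_vec_def)
    then show ?thesis
      by (auto simp: zero_indices_def)
  qed
  then show ?thesis
    unfolding inverse_feasible_single_def by blast
qed

lemma axis_mem_inverse_feasible_single:
  fixes A :: "real ^ 'n ^ 'm"
  assumes "0 \<le> xs" "j \<in> zero_indices xs"
  shows "axis j 1 \<in> inverse_feasible_single A xs"
proof -
  have "axis j 1 = transpose A *v 0 + axis j 1"
    by simp
  moreover have "(0::real ^ 'n) \<le> axis j 1" "\<forall>i. i \<notin> zero_indices xs \<longrightarrow> axis j 1 $ i = (0::real)"
    using assms(2) by (auto simp: axis_def less_eq_vec_def)
  ultimately show ?thesis
    unfolding inverse_feasible_single_altdef[OF assms(1)] by blast
qed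

lemma convex_cone_inverse_feasible_single:
  fixes A :: "real ^ 'n ^ 'm"
  shows "convex_cone (inverse_feasible_single A xs)"
  unfolding convex_cone_iff
proof (intro conjI ballI allI impI)
  show "0 \<in> inverse_feasible_single A xs"
    unfolding inverse_feasible_single_def by (auto intro!: exI[of _ 0])
next
  fix u v assume "u \<in> inverse_feasible_single A xs" "v \<in> inverse_feasible_single A xs"
  then obtain y s y' s' where "u = transpose A *v y + s" "0 \<le> s" "xs \<bullet> s = 0"
    "v = transpose A *v y' + s'" "0 \<le> s'" "xs \<bullet> s' = 0"
    unfolding inverse_feasible_single_def by blast
  then have "u + v = transpose A *v (y + y') + (s + s') \<and> 0 \<le> s + s' \<and> xs \<bullet> (s + s') = 0"
    by (simp add: matrix_vector_right_distrib inner_add_right less_eq_vec_def)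
  then show "u + v \<in> inverse_feasible_single A xs"
    unfolding inverse_feasible_single_def by blast
next
  fix u and t :: real assume "u \<in> inverse_feasible_single A xs" "0 \<le> t"
  then obtain y s where "u = transpose A *v y + s" "0 \<le> s" "xs \<bullet> s = 0"
    unfolding inverse_feasible_single_def by blast
  then have "t *\<^sub>R u = transpose A *v (t *\<^sub>R y) + t *\<^sub>R s \<and> 0 \<le> t *\<^sub>R s \<and> xs \<bullet> (t *\<^sub>R s) = 0"
    using \<open>0 \<le> t\<close> by (simp add: matrix_vector_mult_scaleR scaleR_right_distrib less_eq_vec_def)
  then show "t *\<^sub>R u \<in> inverse_feasible_single A xs"
    unfolding inverse_feasible_single_def by blast
qed

lemma convex_cone_hull_sum:
  assumes "\<And>i. i \<in> I \<Longrightarrow> f i \<in> convex_cone hull S"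
  shows "sum f I \<in> convex_cone hull S"
  using assms
  by (induction I rule: infinite_finite_induct)
    (auto intro: convex_cone_hull_add simp: convex_cone_hull_contains_0)

text \<open>The cone is finitely generated. The free vector \<open>y\<close> contributes the rows of
  \<open>A\<close> with both signs, and \<open>s\<close> contributes the unit vectors at the zero
  entries of \<open>xs\<close>.\<close>

lemma polyhedron_inverse_feasible_single:
  fixes A :: "real ^ 'n ^ 'm"
  assumes "0 \<le> xs"
  shows "polyhedron (inverse_feasible_single A xs)"
proof -
  define G where "G = range (\<lambda>i. row i A) \<union> range (\<lambda>i. - row i A)
    \<union> (\<lambda>j. axis j 1) ` zero_indices xs"
  have row: "t *\<^sub>R row i A \<in> convex_cone hull G" for t i
  proof (cases "0 \<le> t")
    case True
    then show ?thesis
      by (intro convex_cone_hull_mul hull_inc) (auto simp: G_def)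
  next
    case False
    then have "(- t) *\<^sub>R (- row i A) \<in> convex_cone hull G"
      by (intro convex_cone_hull_mul hull_inc) (auto simp: G_def)
    then show ?thesis
      by simp
  qed
  have axis: "s $ j *\<^sub>R axis j 1 \<in> convex_cone hull G"
    if "0 \<le> s" "j \<notin> zero_indices xs \<Longrightarrow> s $ j = 0" for s j
  proof (cases "j \<in> zero_indices xs")
    case True
    then show ?thesis
      using that(1) by (intro convex_cone_hull_mul hull_inc) (auto simp: G_def less_eq_vec_def)
  qed (use that in \<open>simp add: convex_cone_hull_contains_0\<close>)
  have "inverse_feasible_single A xs = convex_cone hull G"
  proof
    show "inverse_feasible_single A xs \<subseteq> convex_cone hull G"
    proof
      fix c assume "c \<in> inverse_feasible_single A xs"
      then obtain y s where c: "c = transpose A *v y + s" "0 \<le> s"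
        and s: "\<And>j. j \<notin> zero_indices xs \<Longrightarrow> s $ j = 0"
        unfolding inverse_feasible_single_altdef[OF assms] by blast
      have "transpose A *v y = (\<Sum>i\<in>UNIV. y $ i *\<^sub>R row i A)"
        by (simp add: matrix_mult_sum scalar_mult_eq_scaleR)
      then have "transpose A *v y \<in> convex_cone hull G"
        by (simp only: convex_cone_hull_sum row)
      moreover have "s = (\<Sum>j\<in>UNIV. s $ j *\<^sub>R axis j 1)"
        using basis_expansion[of s] by (simp add: scalar_mult_eq_scaleR)
      then have "s \<in> convex_cone hull G"
        using convex_cone_hull_sum[of UNIV "\<lambda>j. s $ j *\<^sub>R axis j 1" G] axis[OF c(2) s] by simp
      ultimately show "c \<in> convex_cone hull G"
        unfolding c(1) by (rule convex_cone_hull_add)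
    qed
  next
    have "row i A \<in> inverse_feasible_single A xs" "- row i A \<in> inverse_feasible_single A xs" for i
    proof -
      have "transpose A *v axis i 1 = row i A"
        by (simp add: matrix_vector_mult_basis)
      then have "row i A = transpose A *v axis i 1 + 0" "- row i A = transpose A *v (- axis i 1) + 0"
        using matrix_vector_mult_scaleR[of "transpose A" "-1" "axis i 1"] by simp_all
      then show "row i A \<in> inverse_feasible_single A xs" "- row i A \<in> inverse_feasible_single A xs"
        unfolding inverse_feasible_single_def using inner_zero_right by blast+
    qed
    then have "G \<subseteq> inverse_feasible_single A xs"
      using axis_mem_inverse_feasible_single[OF assms] unfolding G_def by blast
    then show "convex_cone hull G \<subseteq> inverse_feasible_single A xs"
      by (rule hull_minimal) (rule convex_cone_inverse_feasible_single)
  qed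
  moreover have "finite G"
    by (simp add: G_def)
  ultimately show ?thesis
    using polyhedron_convex_cone_hull by metis
qed

text \<open>This identifies the constraints on each \<open>\<xi> k\<close> in the linear problem as
  membership in a dual cone. One direction tests \<xi> against suitable elements of the cone; in the
  other, the \<open>y\<close> part contributes zero and the \<open>s\<close> part is
  nonnegative.\<close>

lemma inverse_feasible_single_dual:
  fixes A :: "real ^ 'n ^ 'm"
  assumes "0 \<le> xs"
  shows "(\<forall>c\<in>inverse_feasible_single A xs. 0 \<le> c \<bullet> \<xi>)
    \<longleftrightarrow> A *v \<xi> = 0 \<and> (\<forall>j\<in>zero_indices xs. 0 \<le> \<xi> $ j)" (is "?L \<longleftrightarrow> ?R")
proof
  assume L: ?L
  \<comment> \<open>With \<open>y = - (A *v \<xi>)\<close> and \<open>s = 0\<close> the inner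
    product with \<xi> is minus the squared norm of \<open>A *v \<xi>\<close>, which is nonnegative
    only if that vector vanishes.\<close>
  have "transpose A *v (- (A *v \<xi>)) + 0 \<in> inverse_feasible_single A xs"
    unfolding inverse_feasible_single_def using inner_zero_right by blast
  then have "0 \<le> (transpose A *v (- (A *v \<xi>)) + 0) \<bullet> \<xi>"
    using L by blast
  then have "A *v \<xi> = 0"
    by (simp only: add_0_right inner_transpose_matrix_vector inner_minus_left)
      (metis inner_eq_zero_iff inner_ge_zero neg_0_le_iff_le order_antisym)
  moreover have "0 \<le> \<xi> $ j" if "j \<in> zero_indices xs" for j
  proof -
    have "axis j 1 \<in> inverse_feasible_single A xs"
      by (rule axis_mem_inverse_feasible_single[OF assms that])
    then show ?thesis
      using L by (auto simp: inner_axis')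
  qed
  ultimately show ?R
    by blast
next
  assume R: ?R
  show ?L
  proof
    fix c assume "c \<in> inverse_feasible_single A xs"
    then obtain y s where c: "c = transpose A *v y + s" "0 \<le> s"
      and s: "\<And>j. j \<notin> zero_indices xs \<Longrightarrow> s $ j = 0"
      unfolding inverse_feasible_single_altdef[OF assms] by blast
    have "0 \<le> s $ j * \<xi> $ j" for j
      using R c(2) s[of j] by (cases "j \<in> zero_indices xs") (auto simp: less_eq_vec_def)
    then have "0 \<le> s \<bullet> \<xi>"
      by (simp add: inner_vec_def sum_nonneg)
    then show "0 \<le> c \<bullet> \<xi>"
      using R by (simp add: c(1) inner_add_left inner_transpose_matrix_vector del: transpose_matrix_vector)
  qed
qed

text \<open>
  If \<open>c\<close> were not in the cone, a separating vector would be a feasible direction at the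
  optimum along which the cost decreases.
\<close>

lemma optimal_imp_inverse_feasible_single:
  fixes A :: "real ^ 'n ^ 'm"
  assumes "optimal_solution (\<lambda>x. ereal (c \<bullet> x)) (lp_feasible A b) xs"
  shows "c \<in> inverse_feasible_single A xs"
proof (rule ccontr)
  have xs: "A *v xs = b" "0 \<le> xs"
    and opt: "\<And>x. A *v x = b \<Longrightarrow> 0 \<le> x \<Longrightarrow> c \<bullet> xs \<le> c \<bullet> x"
    using assms unfolding optimal_solution_def is_arg_min_def lp_feasible_def by (auto simp: not_less)
  assume "c \<notin> inverse_feasible_single A xs"
  then obtain d where "\<And>x. x \<in> inverse_feasible_single A xs \<Longrightarrow> 0 \<le> d \<bullet> x" and neg: "d \<bullet> c < 0"
    using closed_convex_cone_separation convex_cone_inverse_feasible_single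
      polyhedron_imp_closed[OF polyhedron_inverse_feasible_single[OF xs(2)]] by metis
  then have d: "A *v d = 0" "\<And>j. j \<in> zero_indices xs \<Longrightarrow> 0 \<le> d $ j"
    using inverse_feasible_single_dual[OF xs(2), of A d] by (auto simp: inner_commute)
  \<comment> \<open>Zero entries of \<open>xs\<close> stay nonnegative along \<open>d\<close> for
    every positive step; positive entries stay positive for small steps by continuity. As there are
    finitely many entries, one step length serves all of them.\<close>
  have "\<forall>\<^sub>F t in at_right 0. 0 \<le> xs $ j + t * d $ j" for j
  proof (cases "j \<in> zero_indices xs")
    case True
    then show ?thesis
      using d(2)[OF True] by (auto simp: zero_indices_def eventually_at_right_less
          intro!: eventually_mono[OF eventually_at_right_less[of 0]])
  next
    case False
    then have "0 < xs $ j"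
      using xs(2) by (simp add: zero_indices_def less_eq_vec_def order_less_le)
    moreover have "((\<lambda>t. xs $ j + t * d $ j) \<longlongrightarrow> xs $ j + 0 * d $ j) (at_right 0)"
      by (intro tendsto_intros)
    ultimately have "\<forall>\<^sub>F t in at_right 0. 0 < xs $ j + t * d $ j"
      using order_tendstoD(1) by fastforce
    then show ?thesis
      by (rule eventually_mono) simp
  qed
  then have "\<forall>\<^sub>F t in at_right 0. \<forall>j. 0 \<le> xs $ j + t * d $ j"
    by (rule eventually_all_finite)
  then have "\<forall>\<^sub>F t in at_right (0::real). 0 < t \<and> (\<forall>j. 0 \<le> xs $ j + t * d $ j)"
    using eventually_at_right_less[of "0::real"] by (rule eventually_conj[rotated])
  then obtain t where t: "0 < t" "\<And>j. 0 \<le> xs $ j + t * d $ j"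
    using eventually_happens' trivial_limit_at_right_real by blast
  have "c \<bullet> xs \<le> c \<bullet> (xs + t *\<^sub>R d)"
    using t d(1) xs(1)
    by (intro opt) (auto simp: matrix_vector_right_distrib matrix_vector_mult_scaleR less_eq_vec_def)
  then have "0 \<le> t * (d \<bullet> c)"
    by (simp add: inner_add_right inner_commute)
  then show False
    using neg t(1) by (simp add: zero_le_mult_iff)
qed

section \<open>Normalization onto the unit simplex\<close>

lemma scaled_mem_unit_simplex:
  fixes c :: "real ^ 'n"
  assumes "0 \<le> c" "c \<noteq> 0"
  shows "0 < 1 \<bullet> c" "(1 / (1 \<bullet> c)) *\<^sub>R c \<in> unit_simplex"
proof -
  have "1 \<bullet> c = (\<Sum>j\<in>UNIV. c $ j)"
    by (simp add: inner_vec_def)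
  moreover have "(\<Sum>j\<in>UNIV. c $ j) \<noteq> 0"
    using assms by (subst sum_nonneg_eq_0_iff) (auto simp: less_eq_vec_def vec_eq_iff)
  moreover have "0 \<le> (\<Sum>j\<in>UNIV. c $ j)"
    using assms(1) by (auto simp: less_eq_vec_def intro: sum_nonneg)
  ultimately show "0 < 1 \<bullet> c"
    by linarith
  then show "(1 / (1 \<bullet> c)) *\<^sub>R c \<in> unit_simplex"
    using assms(1) by (auto simp: unit_simplex_def less_eq_vec_def)
qed

text \<open>The cones are invariant under positive scaling. This serves twice: it makes the
  uncertainty set nonempty, and it carries bounds from that set over to the whole cone.\<close>

lemma scaled_mem_uncertainty_set:
  fixes A :: "real ^ 'n ^ 'm"
  assumes "0 \<le> c" "c \<noteq> 0" "c \<in> inverse_feasible A K xs"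
  shows "(1 / (1 \<bullet> c)) *\<^sub>R c \<in> uncertainty_set A K xs"
proof -
  have "(1 / (1 \<bullet> c)) *\<^sub>R c \<in> inverse_feasible A K xs"
    using assms(3) scaled_mem_unit_simplex(1)[OF assms(1,2)]
    by (auto simp: inverse_feasible_def
        intro!: convex_cone_scaleR[OF convex_cone_inverse_feasible_single])
  then show ?thesis
    using scaled_mem_unit_simplex(2)[OF assms(1,2)] by (simp add: uncertainty_set_def)
qed

section \<open>The dual of the intersected cones\<close>

text \<open>For nonnegative observed points this is the product over \<open>K\<close> of the dual
  cones of the individual cones.\<close>

definition dual_feasible ::
    "real ^ 'n ^ 'm \<Rightarrow> 'k set \<Rightarrow> ('k \<Rightarrow> real ^ 'n) \<Rightarrow> ('k \<Rightarrow> real ^ 'n) set" where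
  "dual_feasible A K xs =
     {\<xi>. \<forall>k\<in>K. A *v \<xi> k = 0 \<and> (\<forall>j\<in>zero_indices (xs k). 0 \<le> \<xi> k $ j)}"

text \<open>
  For general closed convex cones the dual of the intersection is only the closure of the sum
  of the duals. Polyhedrality is what makes the decomposition exact.
\<close>

lemma inverse_feasible_orthant_dual:
  fixes A :: "real ^ 'n ^ 'm"
  assumes "finite K" "\<And>k. k \<in> K \<Longrightarrow> 0 \<le> xs k"
    and v: "\<And>c. c \<in> inverse_feasible A K xs \<Longrightarrow> 0 \<le> c \<Longrightarrow> 0 \<le> c \<bullet> v"
  obtains \<xi> where "\<xi> \<in> dual_feasible A K xs" "sum \<xi> K \<le> v"
proof -
  \<comment> \<open>\<open>Q\<close> is the sum of the dual cones and the orthant; the orthant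
    summand is the slack in the inequality.\<close>
  define Q where "Q = {u. \<exists>\<xi>\<in>dual_feasible A K xs. sum \<xi> K \<le> u}"
  have "\<exists>F. finite F \<and> inverse_feasible_single A (xs k) = {x. \<forall>a\<in>F. 0 \<le> a \<bullet> x}" if "k \<in> K" for k
    by (rule polyhedral_convex_cone_halfspaces[OF
          polyhedron_inverse_feasible_single[OF assms(2)[OF that], of A]
          convex_cone_inverse_feasible_single]) blast
  then have "\<exists>F. \<forall>k\<in>K. finite (F k) \<and> inverse_feasible_single A (xs k) = {x. \<forall>a\<in>F k. 0 \<le> a \<bullet> x}"
    by (intro bchoice ballI)
  then obtain F where F: "\<And>k. k \<in> K \<Longrightarrow> finite (F k)"
    "\<And>k. k \<in> K \<Longrightarrow> inverse_feasible_single A (xs k) = {x. \<forall>a\<in>F k. 0 \<le> a \<bullet> x}"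
    by blast
  \<comment> \<open>\<open>G\<close> collects the normals of all halfspaces cutting out the
    intersection of the cones with the orthant. By hypothesis \<open>v\<close> is nonnegative on
    that intersection, so Farkas' lemma puts \<open>v\<close> into the cone generated by
    \<open>G\<close>.\<close>
  define G where "G = (\<Union>k\<in>K. F k) \<union> range (\<lambda>j. axis j 1)"
  have "v \<in> convex_cone hull G"
  proof (rule farkas_convex_cone_hull)
    show "finite G"
      using F(1) assms(1) by (simp add: G_def)
    fix x assume x: "\<And>a. a \<in> G \<Longrightarrow> 0 \<le> a \<bullet> x"
    then have "x \<in> inverse_feasible A K xs"
      using F(2) by (auto simp: inverse_feasible_def G_def)
    moreover have "0 \<le> x $ j" for j
      using x[of "axis j 1"] by (simp add: G_def inner_axis')
    ultimately show "0 \<le> x \<bullet> v"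
      using v by (simp add: less_eq_vec_def)
  qed
  moreover have "convex_cone hull G \<subseteq> Q"
  proof (rule hull_minimal)
    show "G \<subseteq> Q"
    proof
      fix a assume "a \<in> G"
      then consider k where "k \<in> K" "a \<in> F k" | j where "a = axis j 1"
        unfolding G_def by blast
      then show "a \<in> Q"
      proof cases
        case 1
        \<comment> \<open>A normal of the cone of \<open>k\<close> is itself a dual vector of that
          cone, so it goes into slot \<open>k\<close> with zeros elsewhere.\<close>
        define \<xi> where "\<xi> = (\<lambda>i. if i = k then a else 0)"
        have "\<forall>c\<in>inverse_feasible_single A (xs k). 0 \<le> c \<bullet> a"
          using F(2)[OF 1(1)] 1(2) by (simp add: inner_commute)
        then have "\<xi> \<in> dual_feasible A K xs"
          using inverse_feasible_single_dual[OF assms(2)[OF 1(1)]]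
          by (auto simp: dual_feasible_def \<xi>_def)
        moreover have "sum \<xi> K = a"
          using assms(1) 1(1) by (simp add: \<xi>_def)
        ultimately show ?thesis
          unfolding Q_def by auto
      next
        case 2
        then show ?thesis
          unfolding Q_def dual_feasible_def by (auto simp: less_eq_vec_def axis_def intro!: exI[of _ "\<lambda>_. 0"])
      qed
    qed
    show "convex_cone Q"
      unfolding convex_cone_iff
    proof (intro conjI ballI allI impI)
      show "0 \<in> Q"
        unfolding Q_def dual_feasible_def by (auto intro!: exI[of _ "\<lambda>_. 0"])
    next
      fix u w assume "u \<in> Q" "w \<in> Q"
      then obtain \<xi> \<eta> where "\<xi> \<in> dual_feasible A K xs" "sum \<xi> K \<le> u"
        "\<eta> \<in> dual_feasible A K xs" "sum \<eta> K \<le> w"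
        unfolding Q_def by blast
      then have "(\<lambda>k. \<xi> k + \<eta> k) \<in> dual_feasible A K xs" "(\<Sum>k\<in>K. \<xi> k + \<eta> k) \<le> u + w"
        by (auto simp: dual_feasible_def matrix_vector_right_distrib sum.distrib less_eq_vec_def
            intro: add_mono)
      then show "u + w \<in> Q"
        unfolding Q_def by blast
    next
      fix u and t :: real assume "u \<in> Q" "0 \<le> t"
      then obtain \<xi> where "\<xi> \<in> dual_feasible A K xs" "sum \<xi> K \<le> u"
        unfolding Q_def by blast
      then have "(\<lambda>k. t *\<^sub>R \<xi> k) \<in> dual_feasible A K xs" "(\<Sum>k\<in>K. t *\<^sub>R \<xi> k) \<le> t *\<^sub>R u"
        using \<open>0 \<le> t\<close> by (auto simp: dual_feasible_def matrix_vector_mult_scaleR less_eq_vec_def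
            scaleR_sum_right[symmetric] mult_left_mono simp del: sum_component)
      then show "t *\<^sub>R u \<in> Q"
        unfolding Q_def by blast
    qed
  qed
  ultimately show thesis
    using that unfolding Q_def by blast
qed

section \<open>Dualizing the inner maximum\<close>

text \<open>Strong duality for the inner maximum. From left to right, homogeneity extends the bound
  to all nonnegative \<open>c\<close> in the cone, and the dual of the intersection decomposes. The
  converse is weak duality: pair the inequality with \<open>c\<close> and use
  \<open>1 \<bullet> c = 1\<close>.\<close>

lemma robust_objective_le_iff:
  fixes A :: "real ^ 'n ^ 'm"
  assumes "finite K" "\<And>k. k \<in> K \<Longrightarrow> 0 \<le> xs k"
  shows "robust_objective (uncertainty_set A K xs) x \<le> ereal \<zeta>
    \<longleftrightarrow> (\<exists>\<xi>\<in>dual_feasible A K xs. sum \<xi> K + x \<le> \<zeta> *\<^sub>R 1)" (is "?L \<longleftrightarrow> ?R")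
proof
  assume ?L
  then have U: "c \<bullet> x \<le> \<zeta>" if "c \<in> uncertainty_set A K xs" for c
    using that by (auto simp: robust_objective_def SUP_le_iff)
  have "0 \<le> c \<bullet> (\<zeta> *\<^sub>R 1 - x)" if c: "c \<in> inverse_feasible A K xs" "0 \<le> c" for c
  \<comment> \<open>The zero vector cannot be normalized, but the inequality is trivial for
    it.\<close>
  proof (cases "c = 0")
    case False
    note pos = scaled_mem_unit_simplex(1)[OF c(2) False]
    have "((1 / (1 \<bullet> c)) *\<^sub>R c) \<bullet> x \<le> \<zeta>"
      by (intro U scaled_mem_uncertainty_set c False)
    then have "c \<bullet> x \<le> \<zeta> * (1 \<bullet> c)"
      using pos by (simp add: field_simps)
    then show ?thesis
      by (simp add: inner_diff_right inner_commute)
  qed simp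
  then obtain \<xi> where "\<xi> \<in> dual_feasible A K xs" "sum \<xi> K \<le> \<zeta> *\<^sub>R 1 - x"
    using inverse_feasible_orthant_dual[where v = "\<zeta> *\<^sub>R 1 - x"] assms by metis
  then show ?R
    by (intro bexI[of _ \<xi>]) (simp_all add: le_diff_eq)
next
  assume ?R
  then obtain \<xi> where \<xi>: "\<xi> \<in> dual_feasible A K xs" "sum \<xi> K + x \<le> \<zeta> *\<^sub>R 1"
    by blast
  have "c \<bullet> x \<le> \<zeta>" if "c \<in> uncertainty_set A K xs" for c
  proof -
    have c: "\<And>k. k \<in> K \<Longrightarrow> c \<in> inverse_feasible_single A (xs k)" "0 \<le> c" "1 \<bullet> c = 1"
      using that by (auto simp: uncertainty_set_def inverse_feasible_def unit_simplex_def)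
    have "0 \<le> c \<bullet> \<xi> k" if "k \<in> K" for k
      using inverse_feasible_single_dual[OF assms(2)[OF that], of A "\<xi> k"] \<xi>(1) c(1) that
      by (auto simp: dual_feasible_def)
    then have "0 \<le> c \<bullet> sum \<xi> K"
      by (simp add: inner_sum_right sum_nonneg)
    moreover have "0 \<le> c \<bullet> (\<zeta> *\<^sub>R 1 - (sum \<xi> K + x))"
      using c(2) \<xi>(2) by (intro inner_nonneg_vec) (simp_all add: less_eq_vec_def)
    ultimately show ?thesis
      using c(3) by (simp add: inner_diff_right inner_add_right inner_commute)
  qed
  then show ?L
    by (auto simp: robust_objective_def SUP_le_iff)
qed

section \<open>Equivalence of the two problems\<close>

lemma reformulation_feasible_iff:
  "(x, \<xi>, \<zeta>) \<in> reformulation_feasible A K xs b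
    \<longleftrightarrow> x \<in> lp_feasible A b \<and> \<xi> \<in> dual_feasible A K xs \<and> sum \<xi> K + x \<le> \<zeta> *\<^sub>R 1"
  unfolding reformulation_feasible_def lp_feasible_def dual_feasible_def by auto

text \<open>A member of \<open>U\<close> excludes the value minus infinity of an empty supremum. On
  the simplex \<open>c \<bullet> x\<close> is a weighted average of the entries of \<open>x\<close>,
  hence at most \<open>infnorm x\<close>.\<close>

lemma robust_objective_finite:
  fixes U :: "(real ^ 'n) set"
  assumes "U \<noteq> {}" "U \<subseteq> unit_simplex"
  obtains \<zeta> where "robust_objective U x = ereal \<zeta>"
proof -
  obtain c where "c \<in> U"
    using assms(1) by blast
  then have "ereal (c \<bullet> x) \<le> robust_objective U x"
    unfolding robust_objective_def by (rule SUP_upper)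
  moreover have "c \<bullet> x \<le> infnorm x" if "c \<in> U" for c
  proof -
    have c: "1 \<bullet> c = 1" "0 \<le> c"
      using that assms(2) by (auto simp: unit_simplex_def)
    have "0 \<le> c \<bullet> (infnorm x *\<^sub>R 1 - x)"
      using c(2) component_le_infnorm_cart[of x]
      by (intro inner_nonneg_vec) (auto simp: less_eq_vec_def abs_le_iff)
    then show ?thesis
      using c(1) by (simp add: inner_diff_right inner_commute)
  qed
  then have "robust_objective U x \<le> ereal (infnorm x)"
    by (auto simp: robust_objective_def SUP_le_iff)
  ultimately show thesis
    using that by (cases "robust_objective U x") auto
qed

theorem theorem2:
  fixes A :: "real ^ 'n ^ 'm"
    and c :: "real ^ 'n"
    and K :: "'k set"
    and bs :: "'k \<Rightarrow> real ^ 'm"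
    and xs :: "'k \<Rightarrow> real ^ 'n"
    and b :: "real ^ 'm"
  assumes "0 \<le> c" and "c \<noteq> 0"
    and "finite K"
    and "\<And>k. k \<in> K \<Longrightarrow> optimal_solution (\<lambda>x. ereal (c \<bullet> x)) (lp_feasible A (bs k)) (xs k)"
  shows "optimal_value (robust_objective (uncertainty_set A K xs)) (lp_feasible A b)
           = optimal_value reformulation_objective (reformulation_feasible A K xs b)
       \<and> (\<forall>x. optimal_solution (robust_objective (uncertainty_set A K xs)) (lp_feasible A b) x
             \<longleftrightarrow> (\<exists>\<xi> \<zeta>. optimal_solution reformulation_objective
                            (reformulation_feasible A K xs b) (x, \<xi>, \<zeta>)))"
proof -
  let ?U = "uncertainty_set A K xs"
  let ?F = "robust_objective ?U"
  let ?S = "lp_feasible A b"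
  let ?R = "reformulation_feasible A K xs b"
  have xs: "0 \<le> xs k" if "k \<in> K" for k
    using assms(4)[OF that] by (simp add: optimal_solution_def is_arg_min_def lp_feasible_def)
  have le_iff: "?F x \<le> ereal \<zeta> \<longleftrightarrow> (\<exists>\<xi>\<in>dual_feasible A K xs. sum \<xi> K + x \<le> \<zeta> *\<^sub>R 1)" for x \<zeta>
    by (rule robust_objective_le_iff[OF assms(3) xs])
  have "c \<in> inverse_feasible A K xs"
    using optimal_imp_inverse_feasible_single[OF assms(4)] by (simp add: inverse_feasible_def)
  then have "?U \<noteq> {}"
    using scaled_mem_uncertainty_set[OF assms(1,2)] by blast
  then have real: "\<exists>\<zeta>. ?F x = ereal \<zeta>" for x
    using robust_objective_finite[of ?U x] by (auto simp: uncertainty_set_def)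
  \<comment> \<open>Together, \<open>upper\<close> and \<open>attained\<close> say that
    \<open>?F x\<close> is the least \<zeta> admissible for a feasible \<open>x\<close>. Both claims
    of the theorem follow from these two facts.\<close>
  have upper: "x \<in> ?S" "?F x \<le> ereal \<zeta>" if "(x, \<xi>, \<zeta>) \<in> ?R" for x \<xi> \<zeta>
    using that le_iff unfolding reformulation_feasible_iff by blast+
  have attained: "\<exists>\<xi> \<zeta>. (x, \<xi>, \<zeta>) \<in> ?R \<and> ?F x = ereal \<zeta>" if "x \<in> ?S" for x
  proof -
    \<comment> \<open>Finiteness of the worst case allows \<zeta> to be chosen equal to it.\<close>
    obtain \<zeta> where "?F x = ereal \<zeta>"
      using real by blast
    moreover from this have "?F x \<le> ereal \<zeta>"
      by simp
    ultimately show ?thesis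
      using that unfolding reformulation_feasible_iff le_iff by blast
  qed
  have same_value: "optimal_value ?F ?S = optimal_value reformulation_objective ?R"
    unfolding optimal_value_def
  proof (rule antisym)
    show "(INF x\<in>?S. ?F x) \<le> (INF p\<in>?R. reformulation_objective p)"
      using upper by (intro INF_mono) (force simp: reformulation_objective_def)
    show "(INF p\<in>?R. reformulation_objective p) \<le> (INF x\<in>?S. ?F x)"
      using attained by (intro INF_mono) (force simp: reformulation_objective_def)
  qed
  have "optimal_solution ?F ?S x
      \<longleftrightarrow> (\<exists>\<xi> \<zeta>. optimal_solution reformulation_objective ?R (x, \<xi>, \<zeta>))" for x
  proof
    assume x: "optimal_solution ?F ?S x"
    then have "x \<in> ?S" and min: "\<And>y. y \<in> ?S \<Longrightarrow> ?F x \<le> ?F y"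
      by (auto simp: optimal_solution_def is_arg_min_def not_less)
    then obtain \<xi> \<zeta> where p: "(x, \<xi>, \<zeta>) \<in> ?R" "?F x = ereal \<zeta>"
      using attained by blast
    \<comment> \<open>The chain is \<open>\<zeta> = ?F x \<le> ?F y \<le> \<zeta>'\<close>.\<close>
    have "\<zeta> \<le> \<zeta>'" if "(y, \<eta>, \<zeta>') \<in> ?R" for y \<eta> \<zeta>'
      using min[OF upper(1)[OF that]] upper(2)[OF that] p(2) by (metis ereal_less_eq(3) order_trans)
    then have "optimal_solution reformulation_objective ?R (x, \<xi>, \<zeta>)"
      using p(1) by (auto simp: optimal_solution_def is_arg_min_def reformulation_objective_def not_less)
    then show "\<exists>\<xi> \<zeta>. optimal_solution reformulation_objective ?R (x, \<xi>, \<zeta>)"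
      by blast
  next
    assume "\<exists>\<xi> \<zeta>. optimal_solution reformulation_objective ?R (x, \<xi>, \<zeta>)"
    then obtain \<xi> \<zeta> where p: "(x, \<xi>, \<zeta>) \<in> ?R"
      and min: "\<And>y \<eta> \<zeta>'. (y, \<eta>, \<zeta>') \<in> ?R \<Longrightarrow> \<zeta> \<le> \<zeta>'"
      by (fastforce simp: optimal_solution_def is_arg_min_def reformulation_objective_def not_less)
    \<comment> \<open>A triple over \<open>y\<close> with last component equal to
      \<open>?F y\<close> competes with the optimal one, so
      \<open>?F x \<le> \<zeta> \<le> ?F y\<close>.\<close>
    have "?F x \<le> ?F y" if "y \<in> ?S" for y
      using attained[OF that] min upper(2)[OF p] by (metis ereal_less_eq(3) order_trans)
    then show "optimal_solution ?F ?S x"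
      using upper(1)[OF p] by (auto simp: optimal_solution_def is_arg_min_def not_less)
  qed
  with same_value show ?thesis
    by blast
qed

end
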